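(* Let $X$ be a real or complex Hilbert space, let $X_1,\dots,X_n$ be closed subspaces of $X$, and let $P_1,\dots,P_n$ be the orthogonal projections onto $X_1,\dots,X_n$, respectively. Let $\varepsilon_{ij}$, $i\neq j$, $i,j\in\{1,\dots,n\}$, be nonnegative numbers with $\varepsilon_{ij}=\varepsilon_{ji}$ such that $\|P_i x\|\leqslant\varepsilon_{ij}\|x\|$ for all $x\in X_j$, for any distinct $i,j\in\{1,\dots,n\}$. Define the $n\times n$ matrix $E=(e_{ij})$ by $e_{ij}=0$ if $i=j$ and $e_{ij}=\varepsilon_{ij}$ if $i\neq j$, let $r(E)$ be the spectral radius of $E$, and set $A:=P_1+\dots+P_n$. If $r(E)<1$, then $$\|I-(I-A)^N-P\|\leqslant (r(E))^N$$ for each integer $N\geqslant 1$, where $P$ is the orthogonal projection onto $X_1+\dots+X_n$.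
   Context: The sum of subspaces is $X_1+\dots+X_n:=\{x_1+\dots+x_n \mid x_1\in X_1,\dots,x_n\in X_n\}$; under the hypothesis $r(E)<1$ this sum is a closed subspace of $X$, so that the orthogonal projection $P$ onto it is well defined. $I$ denotes the identity operator on $X$, and $\|\cdot\|$ applied to operators is the operator norm. *)

theory Defs
  imports
    "HOL-Analysis.Inner_Product"
    "HOL-Analysis.Operator_Norm"
    "Jordan_Normal_Form.Spectral_Radius"
begin

text \<open>
  Real Hilbert spaces are the types of sort \<open>{real_inner, complete_space}\<close>, complex Hilbert spaces
  those of sort \<open>{complex_inner, complete_space}\<close>. The class \<open>complex_inner\<close> extends \<open>real_inner\<close>
  because every complex inner product space carries the real inner product \<open>Re \<langle>x, y\<rangle>\<close>; it induces
  the same norm, since \<open>\<langle>x, x\<rangle>\<close> is real. The complex inner product is linear in its first argument.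
\<close>

class complex_inner = real_inner +
  fixes scaleC :: "complex \<Rightarrow> 'a \<Rightarrow> 'a"
    and cinner :: "'a \<Rightarrow> 'a \<Rightarrow> complex"
  assumes scaleC_add_right: "scaleC c (x + y) = scaleC c x + scaleC c y"
    and scaleC_add_left: "scaleC (c + d) x = scaleC c x + scaleC d x"
    and scaleC_scaleC: "scaleC c (scaleC d x) = scaleC (c * d) x"
    and scaleC_of_real: "scaleC (complex_of_real r) x = scaleR r x"
    and cinner_add_left: "cinner (x + y) z = cinner x z + cinner y z"
    and cinner_scaleC_left: "cinner (scaleC c x) y = c * cinner x y"
    and cinner_commute: "cinner x y = cnj (cinner y x)"
    and Re_cinner: "Re (cinner x y) = inner x y"

interpretation complex_vector: vector_space "scaleC :: complex \<Rightarrow> 'a \<Rightarrow> 'a::complex_inner"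
proof
  show "scaleC 1 x = x" for x :: 'a
    using scaleC_of_real[of 1 x] by simp
qed (simp_all add: scaleC_add_right scaleC_add_left scaleC_scaleC)

abbreviation csubspace :: "'a::complex_inner set \<Rightarrow> bool"
  where "csubspace \<equiv> module.subspace scaleC"

lemma power2_norm_eq_cinner: "cinner x x = complex_of_real ((norm x)\<^sup>2)"
  using cinner_commute[of x x]
  by (simp add: complex_eq_iff Re_cinner power2_norm_eq_inner)

instantiation complex :: complex_inner
begin

definition scaleC_complex :: "complex \<Rightarrow> complex \<Rightarrow> complex"
  where "scaleC_complex c x = c * x"

definition cinner_complex :: "complex \<Rightarrow> complex \<Rightarrow> complex"
  where "cinner_complex x y = x * cnj y"

instance
  by standard
    (simp_all add: scaleC_complex_def cinner_complex_def inner_complex_def algebra_simps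
      scaleR_conv_of_real)

end

text \<open>
  Orthogonal projection onto \<open>M\<close> with respect to the inner product \<open>ip\<close> (\<open>inner\<close> or \<open>cinner\<close>): the
  unique \<open>y \<in> M\<close> with \<open>x - y\<close> orthogonal to \<open>M\<close>. It exists when \<open>M\<close> is a closed subspace of a
  Hilbert space.
\<close>

definition orth_proj :: "('a::minus \<Rightarrow> 'a \<Rightarrow> 'k::zero) \<Rightarrow> 'a set \<Rightarrow> 'a \<Rightarrow> 'a"
  where "orth_proj ip M x = (THE y. y \<in> M \<and> (\<forall>z\<in>M. ip (x - y) z = 0))"

definition subspace_sum :: "nat \<Rightarrow> (nat \<Rightarrow> 'a::comm_monoid_add set) \<Rightarrow> 'a set"
  where "subspace_sum n X = {\<Sum>i<n. x i | x. \<forall>i<n. x i \<in> X i}"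

text \<open>Indices run over \<open>{0..<n}\<close>; the entries are complex because \<open>spectral_radius\<close> requires it.\<close>

definition offdiag_mat :: "nat \<Rightarrow> (nat \<Rightarrow> nat \<Rightarrow> real) \<Rightarrow> complex mat"
  where "offdiag_mat n \<epsilon> = mat n n (\<lambda>(i, j). if i = j then 0 else complex_of_real (\<epsilon> i j))"

end

theory Submission
  imports Defs "HOL-Analysis.L2_Norm" "HOL-Analysis.Elementary_Topology"
begin

text \<open>
  Let \<open>T = I - A\<close> and let \<open>M = X\<^sub>1 + \<dots> + X\<^sub>n\<close>. On the orthogonal complement of \<open>M\<close> every \<open>P\<^sub>i\<close>
  vanishes, so \<open>T\<close> is the identity there; hence \<open>I - T ^ N - P\<close> is \<open>0\<close> on that complement and
  \<open>- T ^ N\<close> on \<open>M\<close>, and it is enough to show \<open>\<parallel>T x\<parallel> \<le> r \<parallel>x\<parallel>\<close> for \<open>x\<close> in the \<open>T\<close>-invariant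
  subspace \<open>M\<close>, where \<open>r = r(E)\<close>.

  Since \<open>T\<close> is symmetric, this bound follows from \<open>\<bar>\<langle>T x, x\<rangle>\<bar> \<le> r \<parallel>x\<parallel>\<^sup>2\<close> on \<open>M\<close>
  (\<open>norm_le_of_symmetric_form\<close>). As \<open>\<langle>T x, x\<rangle> = \<parallel>x\<parallel>\<^sup>2 - \<Sum>\<^sub>i \<parallel>P\<^sub>i x\<parallel>\<^sup>2\<close>, the claim is the frame inequality
  \<open>(1 - r) \<parallel>x\<parallel>\<^sup>2 \<le> \<Sum>\<^sub>i \<parallel>P\<^sub>i x\<parallel>\<^sup>2 \<le> (1 + r) \<parallel>x\<parallel>\<^sup>2\<close>. It is dual to an inequality for the summation map
  \<open>J\<close>, which sends \<open>(f\<^sub>i)\<close> with \<open>f\<^sub>i \<in> X\<^sub>i\<close> to \<open>\<Sum>\<^sub>i f\<^sub>i\<close> and whose adjoint is \<open>x \<mapsto> (P\<^sub>i x)\<close>: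
  \<open>(1 - r) \<Sum>\<^sub>i \<parallel>f\<^sub>i\<parallel>\<^sup>2 \<le> \<parallel>\<Sum>\<^sub>i f\<^sub>i\<parallel>\<^sup>2 \<le> (1 + r) \<Sum>\<^sub>i \<parallel>f\<^sub>i\<parallel>\<^sup>2\<close> (\<open>norm_sum_sub_le\<close>). The lower bound
  here also makes \<open>M\<close> closed, so that \<open>P\<close> exists.

  Expanding the square, the off-diagonal terms satisfy
  \<open>\<bar>\<langle>f\<^sub>i, f\<^sub>j\<rangle>\<bar> = \<bar>\<langle>f\<^sub>i, P\<^sub>i f\<^sub>j\<rangle>\<bar> \<le> \<epsilon>\<^sub>i\<^sub>j \<parallel>f\<^sub>i\<parallel> \<parallel>f\<^sub>j\<parallel>\<close>, so their sum is at most the quadratic form of \<open>E\<close>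
  at the vector \<open>(\<parallel>f\<^sub>i\<parallel>)\<close>. For a real symmetric matrix that form is bounded by the spectral radius
  times the squared Euclidean norm (\<open>symmetric_form_le_spectral_radius\<close>).

  The complex case is the real case for the inner product \<open>Re \<langle>x, y\<rangle>\<close>: orthogonality to a complex
  subspace means the same for both inner products, hence so do orthogonal projections.
\<close>

section \<open>Orthogonal projections in a real Hilbert space\<close>

text \<open>
  The projection theorem. The proof takes a minimising sequence for the distance from \<open>x\<close> to \<open>M\<close>,
  which is Cauchy by the parallelogram law, and perturbs its limit along \<open>z\<close>.
\<close>

lemma orth_proj_exists:
  fixes M :: "'a::{real_inner, complete_space} set"
  assumes "real_vector.subspace M" "closed M"
  shows "\<exists>y\<in>M. \<forall>z\<in>M. inner (x - y) z = 0"
proof -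
  define d where "d = (INF y\<in>M. (norm (x - y))\<^sup>2)"
  have "M \<noteq> {}"
    using real_vector.subspace_0[OF \<open>real_vector.subspace M\<close>] by auto
  have bdd: "bdd_below ((\<lambda>y. (norm (x - y))\<^sup>2) ` M)"
    by (rule bdd_belowI[of _ 0]) auto
  have d_le: "d \<le> (norm (x - y))\<^sup>2" if "y \<in> M" for y
    unfolding d_def using bdd that by (rule cINF_lower)
  have "\<exists>y\<in>M. (norm (x - y))\<^sup>2 < d + inverse (real (Suc k))" for k
    using cINF_less_iff[OF \<open>M \<noteq> {}\<close> bdd, of "d + inverse (real (Suc k))"] by (simp add: d_def)
  then obtain y where y: "\<And>k. y k \<in> M"
    and y_lt: "\<And>k. (norm (x - y k))\<^sup>2 < d + inverse (real (Suc k))"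
    by metis
  have dist_y: "(norm (y k - y l))\<^sup>2 \<le> 2 * inverse (real (Suc k)) + 2 * inverse (real (Suc l))" for k l
  proof -
    have "(1/2) *\<^sub>R (y k + y l) \<in> M"
      by (intro real_vector.subspace_scale real_vector.subspace_add assms y)
    then have "d \<le> (norm (x - (1/2) *\<^sub>R (y k + y l)))\<^sup>2"
      by (rule d_le)
    moreover have "(norm (y k - y l))\<^sup>2 = 2 * (norm (x - y k))\<^sup>2 + 2 * (norm (x - y l))\<^sup>2
        - 4 * (norm (x - (1/2) *\<^sub>R (y k + y l)))\<^sup>2"
      unfolding power2_norm_eq_inner
      by (simp add: inner_diff inner_add inner_commute[of "y k" x] inner_commute[of "y l" x]
          inner_commute[of "y l" "y k"] field_simps)
    ultimately show ?thesis
      using y_lt[of k] y_lt[of l] by linarith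
  qed
  have "Cauchy y"
  proof (rule metric_CauchyI)
    fix e :: real
    assume "0 < e"
    then obtain m where m: "inverse (real (Suc m)) < e\<^sup>2 / 4"
      using reals_Archimedean[of "e\<^sup>2 / 4"] by auto
    have "dist (y k) (y l) < e" if "m \<le> k" "m \<le> l" for k l
    proof -
      have "inverse (real (Suc k)) \<le> inverse (real (Suc m))" "inverse (real (Suc l)) \<le> inverse (real (Suc m))"
        using that by (auto intro!: le_imp_inverse_le)
      then have "(norm (y k - y l))\<^sup>2 < e\<^sup>2"
        using dist_y[of k l] m by linarith
      then show ?thesis
        using \<open>0 < e\<close> by (simp add: dist_norm power_less_imp_less_base)
    qed
    then show "\<exists>m. \<forall>k\<ge>m. \<forall>l\<ge>m. dist (y k) (y l) < e"
      by blast
  qed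
  then obtain p where p: "y \<longlonglongrightarrow> p"
    using Cauchy_convergent convergent_def by blast
  have "p \<in> M"
    using closed_sequentially[OF \<open>closed M\<close> y p] .
  have "(\<lambda>k. (norm (x - y k))\<^sup>2) \<longlonglongrightarrow> (norm (x - p))\<^sup>2"
    by (intro tendsto_intros p)
  moreover have "(\<lambda>k. d + inverse (real (Suc k))) \<longlonglongrightarrow> d + 0"
    by (intro tendsto_intros LIMSEQ_inverse_real_of_nat)
  ultimately have p_le: "(norm (x - p))\<^sup>2 \<le> d"
    using y_lt less_imp_le by (metis (no_types, lifting) LIMSEQ_le add.right_neutral)
  have "inner (x - p) z = 0" if "z \<in> M" for z
  proof (cases "z = 0")
    case False
    \<comment> \<open>the value of \<open>t\<close> that minimises the distance from \<open>x\<close> to \<open>p + t z\<close>\<close>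
    define t where "t = inner (x - p) z / inner z z"
    have "p + t *\<^sub>R z \<in> M"
      by (intro real_vector.subspace_add real_vector.subspace_scale assms \<open>p \<in> M\<close> that)
    then have "(norm (x - p))\<^sup>2 \<le> (norm (x - (p + t *\<^sub>R z)))\<^sup>2"
      by (rule order_trans[OF p_le d_le])
    also have "x - (p + t *\<^sub>R z) = (x - p) - t *\<^sub>R z"
      by simp
    also have "(norm ((x - p) - t *\<^sub>R z))\<^sup>2
        = (norm (x - p))\<^sup>2 - 2 * t * inner (x - p) z + t\<^sup>2 * inner z z"
      unfolding power2_norm_eq_inner inner_diff_left[of "x - p" "t *\<^sub>R z"]
        inner_diff_right[of _ "x - p" "t *\<^sub>R z"]
      by (simp add: inner_commute[of z "x - p"] power2_eq_square)
    also have "\<dots> = (norm (x - p))\<^sup>2 - (inner (x - p) z)\<^sup>2 / inner z z"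
      using False by (simp add: t_def field_simps power2_eq_square)
    finally have "(inner (x - p) z)\<^sup>2 / inner z z \<le> 0"
      by simp
    moreover have "inner z z > 0"
      using False by simp
    ultimately show ?thesis
      by (simp add: divide_le_0_iff)
  qed simp
  with \<open>p \<in> M\<close> show ?thesis
    by blast
qed

lemma orth_proj_unique:
  fixes M :: "'a::real_inner set"
  assumes "real_vector.subspace M" "y \<in> M" "\<And>z. z \<in> M \<Longrightarrow> inner (x - y) z = 0"
  shows "orth_proj inner M x = y"
  unfolding orth_proj_def
proof (rule the_equality)
  fix y'
  assume y': "y' \<in> M \<and> (\<forall>z\<in>M. inner (x - y') z = 0)"
  then have "y' - y \<in> M"
    using assms by (auto intro: real_vector.subspace_diff)
  then have "inner (x - y) (y' - y) - inner (x - y') (y' - y) = 0"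
    using y' assms(3) by simp
  then have "inner (y' - y) (y' - y) = 0"
    by (simp add: inner_diff algebra_simps)
  then show "y' = y"
    by simp
qed (use assms in auto)

context
  fixes M :: "'a::{real_inner, complete_space} set"
  assumes M: "real_vector.subspace M" "closed M"
begin

lemma
  shows orth_proj_in: "orth_proj inner M x \<in> M"
    and orth_proj_orth: "z \<in> M \<Longrightarrow> inner (x - orth_proj inner M x) z = 0"
proof -
  obtain y where y: "y \<in> M" "\<And>z. z \<in> M \<Longrightarrow> inner (x - y) z = 0"
    using orth_proj_exists[OF M] by blast
  then have "orth_proj inner M x = y"
    by (rule orth_proj_unique[OF M(1)])
  with y show "orth_proj inner M x \<in> M" "z \<in> M \<Longrightarrow> inner (x - orth_proj inner M x) z = 0"
    by auto
qed

lemma inner_orth_proj: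
  assumes "z \<in> M"
  shows "inner x z = inner (orth_proj inner M x) z"
proof -
  have "inner x z - inner (orth_proj inner M x) z = 0"
    using orth_proj_orth[OF assms, of x] by (simp only: inner_diff_left)
  then show ?thesis
    by (simp only: right_minus_eq)
qed

lemma linear_orth_proj: "linear (orth_proj inner M)"
proof (rule linearI)
  fix x y :: 'a and c :: real
  show "orth_proj inner M (x + y) = orth_proj inner M x + orth_proj inner M y"
  proof (rule orth_proj_unique[OF M(1)])
    show "inner (x + y - (orth_proj inner M x + orth_proj inner M y)) z = 0" if "z \<in> M" for z
      using orth_proj_orth[OF that, of x] orth_proj_orth[OF that, of y]
      unfolding inner_diff_left inner_add_left by linarith
  qed (intro real_vector.subspace_add M orth_proj_in)
  show "orth_proj inner M (c *\<^sub>R x) = c *\<^sub>R orth_proj inner M x"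
  proof (rule orth_proj_unique[OF M(1)])
    show "inner (c *\<^sub>R x - c *\<^sub>R orth_proj inner M x) z = 0" if "z \<in> M" for z
      using orth_proj_orth[OF that, of x]
      by (simp flip: scaleR_diff_right)
  qed (intro real_vector.subspace_scale M orth_proj_in)
qed

lemma norm_orth_proj_le: "norm (orth_proj inner M x) \<le> norm x"
proof -
  let ?p = "orth_proj inner M x"
  have "(norm ?p)\<^sup>2 = inner x ?p"
    using inner_orth_proj[OF orth_proj_in, of x x] by (simp add: power2_norm_eq_inner)
  also have "\<dots> \<le> norm x * norm ?p"
    by (rule norm_cauchy_schwarz)
  finally show ?thesis
    by (cases "norm ?p = 0") (auto simp: power2_eq_square)
qed

end

section \<open>Complex subspaces as real subspaces\<close>

lemma csubspace_imp_subspace: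
  assumes M: "csubspace M"
  shows "real_vector.subspace M"
proof (rule real_vector.subspaceI)
  show "c *\<^sub>R x \<in> M" if "x \<in> M" for c x
    using complex_vector.subspace_scale[OF M that, of "complex_of_real c"] by (simp only: scaleC_of_real)
qed (simp_all add: complex_vector.subspace_0[OF M] complex_vector.subspace_add[OF M])

lemma subspace_sumI: "(\<And>i. i < n \<Longrightarrow> f i \<in> X i) \<Longrightarrow> (\<Sum>i<n. f i) \<in> subspace_sum n X"
  unfolding subspace_sum_def by blast

text \<open>
  The imaginary part of \<open>\<langle>u, z\<rangle>\<close> is the real part of \<open>\<langle>u, \<i> z\<rangle>\<close>, and \<open>\<i> z\<close> again lies in the complex
  subspace; so real orthogonality to \<open>M\<close> already implies complex orthogonality.
\<close>

lemma orth_proj_cinner_eq_inner: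
  assumes "csubspace M"
  shows "orth_proj cinner M = orth_proj inner M"
proof -
  have "(\<forall>z\<in>M. cinner u z = 0) \<longleftrightarrow> (\<forall>z\<in>M. inner u z = 0)" for u
  proof (intro iffI ballI)
    fix z
    assume "\<forall>z\<in>M. cinner u z = 0" "z \<in> M"
    then show "inner u z = 0"
      by (simp flip: Re_cinner)
  next
    fix z
    assume *: "\<forall>z\<in>M. inner u z = 0" and "z \<in> M"
    then have "scaleC \<i> z \<in> M"
      using assms by (simp add: complex_vector.subspace_scale)
    have "cinner u (scaleC \<i> z) = cnj (cinner (scaleC \<i> z) u)"
      by (rule cinner_commute)
    also have "\<dots> = - \<i> * cinner u z"
      by (simp add: cinner_scaleC_left cinner_commute[of u z])
    finally have "Im (cinner u z) = inner u (scaleC \<i> z)"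
      by (simp flip: Re_cinner)
    with * \<open>z \<in> M\<close> \<open>scaleC \<i> z \<in> M\<close> show "cinner u z = 0"
      by (simp add: complex_eq_iff Re_cinner)
  qed
  then show ?thesis
    unfolding orth_proj_def by simp
qed

lemma csubspace_subspace_sum:
  assumes Y: "\<And>i. i < n \<Longrightarrow> csubspace (Y i)"
  shows "csubspace (subspace_sum n Y)"
proof (rule complex_vector.subspaceI)
  show "0 \<in> subspace_sum n Y"
    using subspace_sumI[of n "\<lambda>_. 0" Y] by (simp add: complex_vector.subspace_0 Y)
next
  fix x y
  assume xy: "x \<in> subspace_sum n Y" "y \<in> subspace_sum n Y"
  obtain f where f: "x = (\<Sum>i<n. f i)" "\<And>i. i < n \<Longrightarrow> f i \<in> Y i"
    using xy(1) unfolding subspace_sum_def by blast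
  obtain g where g: "y = (\<Sum>i<n. g i)" "\<And>i. i < n \<Longrightarrow> g i \<in> Y i"
    using xy(2) unfolding subspace_sum_def by blast
  have "x + y = (\<Sum>i<n. f i + g i)"
    by (simp add: f(1) g(1) sum.distrib)
  also have "\<dots> \<in> subspace_sum n Y"
    by (intro subspace_sumI complex_vector.subspace_add Y f(2) g(2))
  finally show "x + y \<in> subspace_sum n Y" .
next
  fix c x
  assume x: "x \<in> subspace_sum n Y"
  obtain f where f: "x = (\<Sum>i<n. f i)" "\<And>i. i < n \<Longrightarrow> f i \<in> Y i"
    using x unfolding subspace_sum_def by blast
  have "scaleC c x = (\<Sum>i<n. scaleC c (f i))"
    by (simp only: f(1) complex_vector.scale_sum_right)
  also have "\<dots> \<in> subspace_sum n Y"
    by (intro subspace_sumI complex_vector.subspace_scale Y f(2))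
  finally show "scaleC c x \<in> subspace_sum n Y" .
qed

section \<open>The quadratic form of a symmetric matrix\<close>

text \<open>
  Matrix-vector multiplication on functions rather than on the type of matrices: this keeps the
  entries real, while the spectral theory of matrices used below is complex.
\<close>

definition mat_apply :: "nat \<Rightarrow> (nat \<Rightarrow> nat \<Rightarrow> real) \<Rightarrow> (nat \<Rightarrow> real) \<Rightarrow> nat \<Rightarrow> real"
  where "mat_apply n e a i = (\<Sum>j<n. e i j * a j)"

lemma mat_apply_adjoint:
  assumes "\<And>i j. i < n \<Longrightarrow> j < n \<Longrightarrow> e i j = e j i"
  shows "(\<Sum>i<n. mat_apply n e a i * b i) = (\<Sum>i<n. a i * mat_apply n e b i)"
proof -
  have "(\<Sum>i<n. mat_apply n e a i * b i) = (\<Sum>i<n. \<Sum>j<n. e i j * a j * b i)"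
    by (simp add: mat_apply_def sum_distrib_right)
  also have "\<dots> = (\<Sum>j<n. \<Sum>i<n. e i j * a j * b i)"
    by (rule sum.swap)
  also have "\<dots> = (\<Sum>j<n. a j * mat_apply n e b j)"
    unfolding mat_apply_def sum_distrib_left
    using assms by (intro sum.cong refl) (simp add: mult_ac)
  finally show ?thesis .
qed

lemma mat_apply_funpow_adjoint:
  assumes "\<And>i j. i < n \<Longrightarrow> j < n \<Longrightarrow> e i j = e j i"
  shows "(\<Sum>i<n. (mat_apply n e ^^ k) a i * b i) = (\<Sum>i<n. a i * (mat_apply n e ^^ k) b i)"
proof (induction k arbitrary: b)
  case (Suc k)
  show ?case
    using mat_apply_adjoint[of n e "(mat_apply n e ^^ k) a" b, OF assms] Suc[of "mat_apply n e b"]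
    by (simp add: funpow_swap1)
qed simp

lemma sum_mult_le_L2_set: "(\<Sum>i\<in>A. f i * g i) \<le> L2_set f A * L2_set g A"
proof -
  have "(\<Sum>i\<in>A. f i * g i) \<le> (\<Sum>i\<in>A. \<bar>f i\<bar> * \<bar>g i\<bar>)"
    by (rule sum_mono) (metis abs_ge_self abs_mult)
  also have "\<dots> \<le> L2_set f A * L2_set g A"
    by (rule L2_set_mult_ineq)
  finally show ?thesis .
qed

lemma L2_set_power2: "(L2_set f A)\<^sup>2 = (\<Sum>i\<in>A. (f i)\<^sup>2)"
  by (simp add: L2_set_def sum_nonneg)

text \<open>
  For a symmetric matrix \<open>\<parallel>E ^ k a\<parallel>\<^sup>2 = \<langle>a, E ^ (2 k) a\<rangle>\<close>, to which Cauchy-Schwarz applies. Growth of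
  the first power thus propagates to the powers with exponents \<open>2 ^ k\<close>.
\<close>

lemma L2_set_funpow_log_convex:
  assumes "\<And>i j. i < n \<Longrightarrow> j < n \<Longrightarrow> e i j = e j i"
  shows "(L2_set ((mat_apply n e ^^ k) a) {..<n})\<^sup>2
    \<le> L2_set a {..<n} * L2_set ((mat_apply n e ^^ (2 * k)) a) {..<n}"
proof -
  have "(L2_set ((mat_apply n e ^^ k) a) {..<n})\<^sup>2 = (\<Sum>i<n. a i * (mat_apply n e ^^ (2 * k)) a i)"
    using mat_apply_funpow_adjoint[of n e k a "(mat_apply n e ^^ k) a", OF assms]
    unfolding L2_set_power2 by (simp add: power2_eq_square mult_2 funpow_add)
  also have "\<dots> \<le> L2_set a {..<n} * L2_set ((mat_apply n e ^^ (2 * k)) a) {..<n}"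
    by (rule sum_mult_le_L2_set)
  finally show ?thesis .
qed

lemma pow_mat_mult_vec_eq_funpow:
  assumes E: "E = mat n n (\<lambda>(i, j). complex_of_real (e i j))"
  shows "(E ^\<^sub>m k) *\<^sub>v vec n (\<lambda>i. complex_of_real (a i))
    = vec n (\<lambda>i. complex_of_real ((mat_apply n e ^^ k) a i))"
proof (induction k arbitrary: a)
  case 0
  then show ?case
    by (simp add: E)
next
  case (Suc k)
  have "E \<in> carrier_mat n n"
    by (simp add: E)
  have "E *\<^sub>v vec n (\<lambda>i. complex_of_real (a i)) = vec n (\<lambda>i. complex_of_real (mat_apply n e a i))"
    by (rule eq_vecI) (auto simp: E scalar_prod_def mat_apply_def lessThan_atLeast0)
  moreover have "E ^\<^sub>m Suc k *\<^sub>v vec n (\<lambda>i. complex_of_real (a i))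
      = E ^\<^sub>m k *\<^sub>v (E *\<^sub>v vec n (\<lambda>i. complex_of_real (a i)))"
    using \<open>E \<in> carrier_mat n n\<close> by (simp add: assoc_mult_mat_vec[of _ n n])
  ultimately show ?case
    using Suc[of "mat_apply n e a"] by (simp add: funpow_swap1)
qed

text \<open>
  By the Jordan normal form, the powers of a matrix of spectral radius below \<open>1\<close> have bounded entries.
\<close>

lemma bounded_L2_set_funpow:
  assumes "spectral_radius (mat n n (\<lambda>(i, j). complex_of_real (e i j))) < 1"
  shows "\<exists>B. \<forall>k. L2_set ((mat_apply n e ^^ k) a) {..<n} \<le> B"
proof -
  define E where "E = mat n n (\<lambda>(i, j). complex_of_real (e i j))"
  have E: "E \<in> carrier_mat n n"
    by (simp add: E_def)
  obtain c where c: "\<And>k. norm_bound (E ^\<^sub>m k) c"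
    using spectral_radius_jnf_norm_bound_less_1_upper_triangular[OF E] assms
    by (auto simp: E_def)
  have entry: "\<bar>(mat_apply n e ^^ k) a i\<bar> \<le> (\<Sum>j<n. c * \<bar>a j\<bar>)" if "i < n" for i k
  proof -
    have Ek: "E ^\<^sub>m k \<in> carrier_mat n n"
      using E by simp
    have "complex_of_real ((mat_apply n e ^^ k) a i)
        = ((E ^\<^sub>m k) *\<^sub>v vec n (\<lambda>i. complex_of_real (a i))) $ i"
      using that by (simp add: pow_mat_mult_vec_eq_funpow[OF E_def])
    also have "\<dots> = (\<Sum>j<n. (E ^\<^sub>m k) $$ (i, j) * complex_of_real (a j))"
      using that E by (auto simp: scalar_prod_def lessThan_atLeast0 intro!: sum.cong)
    finally have "\<bar>(mat_apply n e ^^ k) a i\<bar> = norm (\<Sum>j<n. (E ^\<^sub>m k) $$ (i, j) * complex_of_real (a j))"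
      by (metis norm_of_real)
    also have "\<dots> \<le> (\<Sum>j<n. norm ((E ^\<^sub>m k) $$ (i, j) * complex_of_real (a j)))"
      by (rule norm_sum)
    also have "\<dots> \<le> (\<Sum>j<n. c * \<bar>a j\<bar>)"
    proof (rule sum_mono)
      fix j
      assume "j \<in> {..<n}"
      then have "norm ((E ^\<^sub>m k) $$ (i, j)) \<le> c"
        using c[of k] that Ek unfolding norm_bound_def by (metis carrier_matD lessThan_iff)
      then show "norm ((E ^\<^sub>m k) $$ (i, j) * complex_of_real (a j)) \<le> c * \<bar>a j\<bar>"
        by (simp add: norm_mult mult_right_mono)
    qed
    finally show ?thesis .
  qed
  have "L2_set ((mat_apply n e ^^ k) a) {..<n} \<le> (\<Sum>i<n. \<Sum>j<n. c * \<bar>a j\<bar>)" for k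
    by (rule order_trans[OF L2_set_le_sum_abs sum_mono]) (use entry in auto)
  then show ?thesis
    by blast
qed

text \<open>
  If \<open>\<parallel>E a\<parallel> = t \<parallel>a\<parallel>\<close> with \<open>t > 1\<close>, then log-convexity gives \<open>\<parallel>E ^ (2 ^ k) a\<parallel> \<ge> t ^ (2 ^ k) \<parallel>a\<parallel>\<close>,
  which contradicts the boundedness of the powers.
\<close>

lemma L2_set_mat_apply_le:
  assumes sym: "\<And>i j. i < n \<Longrightarrow> j < n \<Longrightarrow> e i j = e j i"
    and "spectral_radius (mat n n (\<lambda>(i, j). complex_of_real (e i j))) < 1"
  shows "L2_set (mat_apply n e a) {..<n} \<le> L2_set a {..<n}"
proof (rule ccontr)
  define w where "w k = L2_set ((mat_apply n e ^^ k) a) {..<n}" for k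
  define t where "t = w 1 / w 0"
  assume "\<not> ?thesis"
  then have "w 0 < w 1"
    by (simp add: w_def)
  have "w 0 \<noteq> 0"
  proof
    assume "w 0 = 0"
    then have "\<forall>i<n. a i = 0"
      by (simp add: w_def L2_set_eq_0_iff)
    then have "w 1 = 0"
      by (simp add: w_def mat_apply_def L2_set_def)
    with \<open>w 0 = 0\<close> \<open>w 0 < w 1\<close> show False
      by simp
  qed
  then have "0 < w 0"
    by (simp add: w_def less_le)
  then have "1 < t"
    using \<open>w 0 < w 1\<close> by (simp add: t_def)
  have grow: "t ^ (2 ^ k) * w 0 \<le> w (2 ^ k)" for k
  proof (induction k)
    case 0
    then show ?case
      using \<open>0 < w 0\<close> by (simp add: t_def)
  next
    case (Suc k)
    have "(t ^ (2 ^ k) * w 0)\<^sup>2 \<le> (w (2 ^ k))\<^sup>2"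
      using Suc \<open>1 < t\<close> \<open>0 < w 0\<close> by (intro power_mono) auto
    also have "\<dots> \<le> w 0 * w (2 * 2 ^ k)"
      using L2_set_funpow_log_convex[of n e "2 ^ k" a, OF sym] by (simp add: w_def)
    finally have "w 0 * (t ^ (2 ^ Suc k) * w 0) \<le> w 0 * w (2 ^ Suc k)"
      by (simp add: power2_eq_square power_mult_distrib mult_ac flip: power_add mult_2)
    then show ?case
      using \<open>0 < w 0\<close> by simp
  qed
  obtain B where B: "\<And>k. w k \<le> B"
    using bounded_L2_set_funpow[OF assms(2)] unfolding w_def by blast
  obtain m where "B / w 0 < t ^ m"
    using real_arch_pow[OF \<open>1 < t\<close>] by blast
  also have "\<dots> \<le> t ^ (2 ^ m)"
    using \<open>1 < t\<close> by (intro power_increasing) (auto intro: less_imp_le)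
  finally have "B < t ^ (2 ^ m) * w 0"
    using \<open>0 < w 0\<close> by (simp add: field_simps)
  with grow[of m] B[of "2 ^ m"] show False
    by linarith
qed

text \<open>
  An eigenvalue \<open>\<mu>\<close> of \<open>s\<^sup>-\<^sup>1 E\<close> gives the eigenvalue \<open>s \<mu>\<close> of \<open>E\<close>.
\<close>

lemma spectral_radius_divide_less_1:
  fixes E :: "complex mat"
  assumes E: "E \<in> carrier_mat n n" "0 < n"
    and s: "0 < s" "spectral_radius E < s"
  shows "spectral_radius (complex_of_real (inverse s) \<cdot>\<^sub>m E) < 1"
proof -
  let ?S = "complex_of_real (inverse s) \<cdot>\<^sub>m E"
  have S: "?S \<in> carrier_mat n n"
    using E by simp
  obtain \<mu> where \<mu>: "\<mu> \<in> spectrum ?S" "spectral_radius ?S = norm \<mu>"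
    using spectral_radius_mem_max(1)[OF S \<open>0 < n\<close>] by auto
  then obtain v where v: "v \<in> carrier_vec n" "v \<noteq> 0\<^sub>v n" "?S *\<^sub>v v = \<mu> \<cdot>\<^sub>v v"
    using S by (auto simp: spectrum_def eigenvalue_def eigenvector_def)
  have "complex_of_real s \<cdot>\<^sub>v (?S *\<^sub>v v) = E *\<^sub>v v"
    using E v(1) s(1)
    by (intro eq_vecI) (auto simp: scalar_prod_def sum_distrib_left intro!: sum.cong)
  then have "E *\<^sub>v v = (complex_of_real s * \<mu>) \<cdot>\<^sub>v v"
    using v(3) by (simp add: smult_smult_assoc)
  then have "complex_of_real s * \<mu> \<in> spectrum E"
    using v E by (auto simp: spectrum_def eigenvalue_def eigenvector_def)
  then have "norm (complex_of_real s * \<mu>) \<le> spectral_radius E"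
    by (intro spectral_radius_mem_max(2)[OF E]) auto
  then have "s * norm \<mu> \<le> spectral_radius E"
    using s by (simp add: norm_mult)
  then have "s * norm \<mu> < s * 1"
    using s by linarith
  then have "norm \<mu> < 1"
    using s(1) by (rule mult_left_less_imp_less[OF _ less_imp_le])
  then show ?thesis
    using s(1) \<mu>(2) by simp
qed

text \<open>
  For every \<open>s\<close> above the spectral radius the rescaled matrix \<open>s\<^sup>-\<^sup>1 E\<close> does not increase the
  Euclidean norm, so \<open>\<parallel>E a\<parallel> \<le> s \<parallel>a\<parallel>\<close>; then \<open>s\<close> tends to the spectral radius.
\<close>

lemma symmetric_form_le_spectral_radius:
  assumes "0 < n" and sym: "\<And>i j. i < n \<Longrightarrow> j < n \<Longrightarrow> e i j = e j i"
  shows "(\<Sum>i<n. \<Sum>j<n. e i j * a i * a j)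
    \<le> spectral_radius (mat n n (\<lambda>(i, j). complex_of_real (e i j))) * (\<Sum>i<n. (a i)\<^sup>2)"
proof -
  define E where "E = mat n n (\<lambda>(i, j). complex_of_real (e i j))"
  have E: "E \<in> carrier_mat n n"
    by (simp add: E_def)
  have "0 \<le> spectral_radius E"
    using spectral_radius_mem_max(1)[OF E \<open>0 < n\<close>] by auto
  have "L2_set (mat_apply n e a) {..<n} \<le> s * L2_set a {..<n}" if s: "spectral_radius E < s" for s
  proof -
    have "0 < s"
      using s \<open>0 \<le> spectral_radius E\<close> by simp
    have "mat n n (\<lambda>(i, j). complex_of_real (inverse s * e i j)) = complex_of_real (inverse s) \<cdot>\<^sub>m E"
      by (rule eq_matI) (auto simp: E_def)
    then have "L2_set (mat_apply n (\<lambda>i j. inverse s * e i j) a) {..<n} \<le> L2_set a {..<n}"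
      using spectral_radius_divide_less_1[OF E \<open>0 < n\<close> \<open>0 < s\<close> s] sym
      by (intro L2_set_mat_apply_le) auto
    moreover have "mat_apply n (\<lambda>i j. inverse s * e i j) a = (\<lambda>i. inverse s * mat_apply n e a i)"
      by (auto simp: mat_apply_def sum_distrib_left mult_ac)
    ultimately have "inverse s * L2_set (mat_apply n e a) {..<n} \<le> L2_set a {..<n}"
      using \<open>0 < s\<close> by (simp add: L2_set_right_distrib)
    then show ?thesis
      using \<open>0 < s\<close> by (simp add: field_simps)
  qed
  then have F: "L2_set (mat_apply n e a) {..<n} / L2_set a {..<n} \<le> s"
    if "spectral_radius E < s" for s
    using that \<open>0 \<le> spectral_radius E\<close>
    by (cases "L2_set a {..<n} = 0") (auto simp: divide_le_eq less_le)
  have "(\<Sum>i<n. \<Sum>j<n. e i j * a i * a j) = (\<Sum>i<n. a i * mat_apply n e a i)"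
    by (simp add: mat_apply_def sum_distrib_left mult_ac)
  also have "\<dots> \<le> L2_set a {..<n} * L2_set (mat_apply n e a) {..<n}"
    by (rule sum_mult_le_L2_set)
  also have "\<dots> \<le> L2_set a {..<n} * (spectral_radius E * L2_set a {..<n})"
  proof (cases "L2_set a {..<n} = 0")
    case False
    then have "0 < L2_set a {..<n}"
      by (simp add: less_le)
    moreover have "L2_set (mat_apply n e a) {..<n} / L2_set a {..<n} \<le> spectral_radius E"
      by (rule dense_ge) (rule F)
    ultimately show ?thesis
      by (intro mult_left_mono) (auto simp: field_simps)
  qed simp
  also have "\<dots> = spectral_radius E * (\<Sum>i<n. (a i)\<^sup>2)"
    unfolding L2_set_power2[symmetric] by (simp add: power2_eq_square mult_ac)
  finally show ?thesis
    by (simp add: E_def)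
qed

section \<open>Symmetric operators\<close>

text \<open>
  By polarisation \<open>4 \<langle>T x, y\<rangle>\<close> is the difference of the form at \<open>x + y\<close> and at \<open>x - y\<close>, so the
  parallelogram law bounds \<open>\<langle>T x, y\<rangle>\<close> by \<open>r (\<parallel>x\<parallel>\<^sup>2 + \<parallel>y\<parallel>\<^sup>2) / 2\<close>. The multiple \<open>y\<close> of \<open>T x\<close> with
  \<open>\<parallel>y\<parallel> = \<parallel>x\<parallel>\<close> yields the claim.
\<close>

lemma norm_le_of_symmetric_form:
  fixes T :: "'a::real_inner \<Rightarrow> 'a"
  assumes "linear T" "real_vector.subspace M" "T x \<in> M" "x \<in> M" "0 \<le> r"
    and sym: "\<And>x y. inner (T x) y = inner x (T y)"
    and form: "\<And>x. x \<in> M \<Longrightarrow> \<bar>inner (T x) x\<bar> \<le> r * (norm x)\<^sup>2"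
  shows "norm (T x) \<le> r * norm x"
proof (cases "x = 0 \<or> T x = 0")
  case True
  then show ?thesis
    using linear_0[OF \<open>linear T\<close>] \<open>0 \<le> r\<close> by auto
next
  case False
  define c where "c = norm x / norm (T x)"
  define y where "y = c *\<^sub>R T x"
  have "y \<in> M"
    by (simp add: y_def real_vector.subspace_scale assms)
  have norm_y: "norm y = norm x"
    using False by (simp add: y_def c_def)
  have "4 * inner (T x) y = inner (T (x + y)) (x + y) - inner (T (x - y)) (x - y)"
    using sym[of y x]
    by (simp add: linear_add[OF \<open>linear T\<close>] linear_diff[OF \<open>linear T\<close>] inner_add inner_diff
        inner_commute[of y "T x"])
  also have "\<dots> \<le> r * (norm (x + y))\<^sup>2 + r * (norm (x - y))\<^sup>2"
    using form[of "x + y"] form[of "x - y"] real_vector.subspace_add[OF \<open>real_vector.subspace M\<close> \<open>x \<in> M\<close> \<open>y \<in> M\<close>]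
      real_vector.subspace_diff[OF \<open>real_vector.subspace M\<close> \<open>x \<in> M\<close> \<open>y \<in> M\<close>] by linarith
  also have "\<dots> = r * (2 * (norm x)\<^sup>2 + 2 * (norm y)\<^sup>2)"
    unfolding power2_norm_eq_inner by (simp add: inner_add inner_diff inner_commute[of y x] algebra_simps)
  finally have "inner (T x) y \<le> r * (norm x)\<^sup>2"
    by (simp add: norm_y)
  moreover have "inner (T x) y = norm x * norm (T x)"
    using False by (simp add: y_def c_def power2_norm_eq_inner[symmetric] power2_eq_square)
  ultimately have "norm x * norm (T x) \<le> norm x * (r * norm x)"
    by (simp add: power2_eq_square mult_ac)
  then show ?thesis
    using False by simp
qed

section \<open>Almost orthogonal families of subspaces\<close>

text \<open>
  The number \<open>r\<close> stands for any bound below \<open>1\<close> on the quadratic form of \<open>E\<close>; the spectral radius is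
  one such bound.
\<close>

locale almost_orthogonal_subspaces =
  fixes n :: nat and X :: "nat \<Rightarrow> 'a::{real_inner, complete_space} set"
    and \<epsilon> :: "nat \<Rightarrow> nat \<Rightarrow> real" and r :: real
  assumes subspace_X: "i < n \<Longrightarrow> real_vector.subspace (X i)"
    and closed_X: "i < n \<Longrightarrow> closed (X i)"
    and r_nonneg: "0 \<le> r" and r_less_1: "r < 1"
    and norm_proj_le: "i < n \<Longrightarrow> j < n \<Longrightarrow> i \<noteq> j \<Longrightarrow> x \<in> X j \<Longrightarrow>
      norm (orth_proj inner (X i) x) \<le> \<epsilon> i j * norm x"
    and form_le: "(\<Sum>i<n. \<Sum>j<n. (if i = j then 0 else \<epsilon> i j) * a i * a j) \<le> r * (\<Sum>i<n. (a i)\<^sup>2)"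
begin

abbreviation proj :: "nat \<Rightarrow> 'a \<Rightarrow> 'a"
  where "proj i \<equiv> orth_proj inner (X i)"

abbreviation M :: "'a set"
  where "M \<equiv> subspace_sum n X"

definition T :: "'a \<Rightarrow> 'a"
  where "T x = x - (\<Sum>i<n. proj i x)"

text \<open>
  The off-diagonal terms of \<open>\<parallel>\<Sum>\<^sub>i f\<^sub>i\<parallel>\<^sup>2\<close> are \<open>\<langle>f\<^sub>i, f\<^sub>j\<rangle> = \<langle>f\<^sub>i, P\<^sub>i f\<^sub>j\<rangle>\<close>; their sum is controlled by
  the quadratic form at the vector of norms \<open>(\<parallel>f\<^sub>i\<parallel>)\<close>.
\<close>

lemma norm_sum_sub_le:
  assumes f: "\<And>i. i < n \<Longrightarrow> f i \<in> X i"
  shows "\<bar>(norm (\<Sum>i<n. f i))\<^sup>2 - (\<Sum>i<n. (norm (f i))\<^sup>2)\<bar> \<le> r * (\<Sum>i<n. (norm (f i))\<^sup>2)"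
proof -
  have off: "\<bar>inner (f i) (f j)\<bar> \<le> \<epsilon> i j * norm (f i) * norm (f j)" if "i < n" "j < n" "i \<noteq> j" for i j
  proof -
    have "inner (f j) (f i) = inner (proj i (f j)) (f i)"
      using that f by (intro inner_orth_proj subspace_X closed_X)
    then have "\<bar>inner (f i) (f j)\<bar> \<le> norm (proj i (f j)) * norm (f i)"
      by (metis Cauchy_Schwarz_ineq2 inner_commute)
    also have "\<dots> \<le> \<epsilon> i j * norm (f j) * norm (f i)"
      using that f by (intro mult_right_mono norm_proj_le) auto
    finally show ?thesis
      by (simp add: mult_ac)
  qed
  have "(norm (\<Sum>i<n. f i))\<^sup>2 = (\<Sum>i<n. \<Sum>j<n. inner (f i) (f j))"
    by (simp add: power2_norm_eq_inner inner_sum_left inner_sum_right inner_commute)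
  moreover have "(\<Sum>i<n. (norm (f i))\<^sup>2) = (\<Sum>i<n. \<Sum>j<n. if i = j then inner (f i) (f j) else 0)"
    by (simp add: power2_norm_eq_inner)
  ultimately have "(norm (\<Sum>i<n. f i))\<^sup>2 - (\<Sum>i<n. (norm (f i))\<^sup>2)
      = (\<Sum>i<n. \<Sum>j<n. if i = j then 0 else inner (f i) (f j))"
    by (simp only: sum_subtractf[symmetric]) (intro sum.cong refl, simp)
  also have "\<bar>\<dots>\<bar> \<le> (\<Sum>i<n. \<Sum>j<n. \<bar>if i = j then 0 else inner (f i) (f j)\<bar>)"
    by (rule order_trans[OF sum_abs sum_mono[OF sum_abs]])
  also have "\<dots> \<le> (\<Sum>i<n. \<Sum>j<n. (if i = j then 0 else \<epsilon> i j) * norm (f i) * norm (f j))"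
    using off by (intro sum_mono) auto
  also have "\<dots> \<le> r * (\<Sum>i<n. (norm (f i))\<^sup>2)"
    by (rule form_le)
  finally show ?thesis .
qed

lemma
  assumes "\<And>i. i < n \<Longrightarrow> f i \<in> X i"
  shows norm_sum_upper: "(norm (\<Sum>i<n. f i))\<^sup>2 \<le> (1 + r) * (\<Sum>i<n. (norm (f i))\<^sup>2)"
    and norm_sum_lower: "(1 - r) * (\<Sum>i<n. (norm (f i))\<^sup>2) \<le> (norm (\<Sum>i<n. f i))\<^sup>2"
  using norm_sum_sub_le[of f] assms by (auto simp: algebra_simps abs_le_iff)

lemma subspace_M: "real_vector.subspace M"
proof (rule real_vector.subspaceI)
  show "0 \<in> M"
    using subspace_sumI[of n "\<lambda>_. 0" X] by (simp add: real_vector.subspace_0 subspace_X)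
next
  fix x y
  assume xy: "x \<in> M" "y \<in> M"
  obtain f where f: "x = (\<Sum>i<n. f i)" "\<And>i. i < n \<Longrightarrow> f i \<in> X i"
    using xy(1) unfolding subspace_sum_def by blast
  obtain g where g: "y = (\<Sum>i<n. g i)" "\<And>i. i < n \<Longrightarrow> g i \<in> X i"
    using xy(2) unfolding subspace_sum_def by blast
  have "x + y = (\<Sum>i<n. f i + g i)"
    by (simp add: f(1) g(1) sum.distrib)
  also have "\<dots> \<in> M"
    by (intro subspace_sumI real_vector.subspace_add subspace_X f(2) g(2))
  finally show "x + y \<in> M" .
next
  fix c x
  assume x: "x \<in> M"
  obtain f where f: "x = (\<Sum>i<n. f i)" "\<And>i. i < n \<Longrightarrow> f i \<in> X i"
    using x unfolding subspace_sum_def by blast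
  have "c *\<^sub>R x = (\<Sum>i<n. c *\<^sub>R f i)"
    by (simp only: f(1) scaleR_sum_right)
  also have "\<dots> \<in> M"
    by (intro subspace_sumI real_vector.subspace_scale subspace_X f(2))
  finally show "c *\<^sub>R x \<in> M" .
qed

lemma X_subset_M:
  assumes "i < n" "x \<in> X i"
  shows "x \<in> M"
proof -
  have "x = (\<Sum>j<n. if j = i then x else 0)"
    using assms by simp
  also have "\<dots> \<in> M"
    using assms by (intro subspace_sumI) (auto simp: real_vector.subspace_0 subspace_X)
  finally show ?thesis .
qed

text \<open>
  The summation map is bounded below, so the components of a convergent sequence in \<open>M\<close> are Cauchy
  and converge in the closed subspaces \<open>X\<^sub>i\<close>.
\<close>

lemma closed_M: "closed M"
  unfolding closed_sequential_limits
proof (intro allI impI)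
  fix s x
  assume s: "(\<forall>k. s k \<in> M) \<and> s \<longlonglongrightarrow> x"
  then have "\<forall>k. \<exists>f. s k = (\<Sum>i<n. f i) \<and> (\<forall>i<n. f i \<in> X i)"
    unfolding subspace_sum_def by blast
  then obtain f where f: "\<And>k. s k = (\<Sum>i<n. f k i)" "\<And>k i. i < n \<Longrightarrow> f k i \<in> X i"
    by metis
  have comp: "(1 - r) * (norm (f k i - f l i))\<^sup>2 \<le> (norm (s k - s l))\<^sup>2" if "i < n" for i k l
  proof -
    have "(norm (f k i - f l i))\<^sup>2 \<le> (\<Sum>i<n. (norm (f k i - f l i))\<^sup>2)"
      using that by (intro member_le_sum) auto
    then have "(1 - r) * (norm (f k i - f l i))\<^sup>2 \<le> (1 - r) * (\<Sum>i<n. (norm (f k i - f l i))\<^sup>2)"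
      using r_less_1 by (intro mult_left_mono) auto
    also have "\<dots> \<le> (norm (\<Sum>i<n. f k i - f l i))\<^sup>2"
      using f(2) by (intro norm_sum_lower real_vector.subspace_diff subspace_X) auto
    finally show ?thesis
      by (simp add: f(1) sum_subtractf)
  qed
  have "convergent (\<lambda>k. f k i)" if "i < n" for i
  proof (rule Cauchy_convergent, rule metric_CauchyI)
    fix e :: real
    assume "0 < e"
    have "Cauchy s"
      using s by (auto intro: LIMSEQ_imp_Cauchy)
    moreover have "0 < sqrt (1 - r) * e"
      using r_less_1 \<open>0 < e\<close> by simp
    ultimately obtain m where m: "\<And>k l. m \<le> k \<Longrightarrow> m \<le> l \<Longrightarrow> dist (s k) (s l) < sqrt (1 - r) * e"
      unfolding Cauchy_def by meson
    have "dist (f k i) (f l i) < e" if "m \<le> k" "m \<le> l" for k l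
    proof -
      have "(norm (s k - s l))\<^sup>2 < (sqrt (1 - r) * e)\<^sup>2"
        using m[OF that] by (intro power_strict_mono) (auto simp: dist_norm)
      also have "\<dots> = (1 - r) * e\<^sup>2"
        using r_less_1 by (simp add: power_mult_distrib)
      finally have "(1 - r) * (norm (f k i - f l i))\<^sup>2 < (1 - r) * e\<^sup>2"
        using comp[OF \<open>i < n\<close>, of k l] by linarith
      then have "(norm (f k i - f l i))\<^sup>2 < e\<^sup>2"
        by (rule mult_left_less_imp_less) (use r_less_1 in simp)
      then show ?thesis
        using \<open>0 < e\<close> by (simp add: dist_norm power_less_imp_less_base)
    qed
    then show "\<exists>m. \<forall>k\<ge>m. \<forall>l\<ge>m. dist (f k i) (f l i) < e"
      by blast
  qed
  then have "\<forall>i. \<exists>y. i < n \<longrightarrow> (\<lambda>k. f k i) \<longlonglongrightarrow> y"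
    by (auto simp: convergent_def)
  then obtain g where g: "\<And>i. i < n \<Longrightarrow> (\<lambda>k. f k i) \<longlonglongrightarrow> g i"
    by metis
  have "(\<lambda>k. \<Sum>i<n. f k i) \<longlonglongrightarrow> (\<Sum>i<n. g i)"
    by (intro tendsto_sum g) auto
  then have "s \<longlonglongrightarrow> (\<Sum>i<n. g i)"
    by (simp flip: f(1))
  then have "x = (\<Sum>i<n. g i)"
    using s LIMSEQ_unique by blast
  moreover have "g i \<in> X i" if "i < n" for i
    using closed_sequentially[OF closed_X[OF that] f(2)[OF that] g[OF that]] .
  ultimately show "x \<in> M"
    using subspace_sumI by blast
qed

lemma linear_T: "linear T"
proof -
  have lin: "linear (proj i)" if "i < n" for i
    using that by (intro linear_orth_proj subspace_X closed_X)
  show ?thesis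
  proof (rule linearI)
    fix x y :: 'a and c :: real
    have "(\<Sum>i<n. proj i (x + y)) = (\<Sum>i<n. proj i x) + (\<Sum>i<n. proj i y)"
      by (simp add: linear_add[OF lin] sum.distrib)
    then show "T (x + y) = T x + T y"
      by (simp add: T_def)
    have "(\<Sum>i<n. proj i (c *\<^sub>R x)) = c *\<^sub>R (\<Sum>i<n. proj i x)"
      by (simp add: linear_scale[OF lin] scaleR_sum_right)
    then show "T (c *\<^sub>R x) = c *\<^sub>R T x"
      by (simp add: T_def scaleR_diff_right)
  qed
qed

lemma proj_in: "i < n \<Longrightarrow> proj i x \<in> X i"
  by (intro orth_proj_in subspace_X closed_X)

lemma inner_proj: "i < n \<Longrightarrow> z \<in> X i \<Longrightarrow> inner x z = inner (proj i x) z"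
  by (intro inner_orth_proj subspace_X closed_X)

lemma sym_T: "inner (T x) y = inner x (T y)"
proof -
  have "inner (proj i x) y = inner x (proj i y)" if "i < n" for i
  proof -
    have "inner (proj i x) y = inner y (proj i x)"
      by (rule inner_commute)
    also have "\<dots> = inner (proj i y) (proj i x)"
      by (rule inner_proj[OF that proj_in[OF that]])
    also have "\<dots> = inner (proj i x) (proj i y)"
      by (rule inner_commute)
    also have "\<dots> = inner x (proj i y)"
      by (rule inner_proj[OF that proj_in[OF that], symmetric])
    finally show ?thesis .
  qed
  then show ?thesis
    by (simp add: T_def inner_diff inner_sum_left inner_sum_right)
qed

lemma T_in_M: "x \<in> M \<Longrightarrow> T x \<in> M"
  unfolding T_def by (intro real_vector.subspace_diff subspace_M subspace_sumI proj_in)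

lemma inner_T: "inner (T x) x = (norm x)\<^sup>2 - (\<Sum>i<n. (norm (proj i x))\<^sup>2)"
proof -
  have "inner (proj i x) x = (norm (proj i x))\<^sup>2" if "i < n" for i
    using inner_proj[OF that proj_in[OF that], of x x] by (metis inner_commute power2_norm_eq_inner)
  then show ?thesis
    by (simp add: T_def inner_diff inner_sum_left power2_norm_eq_inner)
qed

text \<open>
  The summation map has norm at most \<open>sqrt (1 + r)\<close>, hence so does its adjoint \<open>x \<mapsto> (P\<^sub>i x)\<close>:
  with \<open>S = \<Sum>\<^sub>i \<parallel>P\<^sub>i x\<parallel>\<^sup>2 = \<langle>x, \<Sum>\<^sub>i P\<^sub>i x\<rangle>\<close>, Cauchy-Schwarz gives \<open>S\<^sup>2 \<le> \<parallel>x\<parallel>\<^sup>2 (1 + r) S\<close>.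
\<close>

lemma sum_norm_proj_le: "(\<Sum>i<n. (norm (proj i x))\<^sup>2) \<le> (1 + r) * (norm x)\<^sup>2"
proof -
  define S where "S = (\<Sum>i<n. (norm (proj i x))\<^sup>2)"
  have "0 \<le> S"
    by (simp add: S_def sum_nonneg)
  have "S = inner x (\<Sum>i<n. proj i x)"
    unfolding S_def inner_sum_right
    by (intro sum.cong refl) (metis inner_proj lessThan_iff power2_norm_eq_inner proj_in)
  then have "S\<^sup>2 \<le> (norm x)\<^sup>2 * (norm (\<Sum>i<n. proj i x))\<^sup>2"
    using Cauchy_Schwarz_ineq[of x "\<Sum>i<n. proj i x"] by (simp add: power2_norm_eq_inner)
  also have "\<dots> \<le> (norm x)\<^sup>2 * ((1 + r) * S)"
    unfolding S_def by (intro mult_left_mono norm_sum_upper proj_in) auto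
  finally have "S * S \<le> S * ((1 + r) * (norm x)\<^sup>2)"
    by (simp add: power2_eq_square mult_ac)
  then show ?thesis
    using \<open>0 \<le> S\<close> r_nonneg by (cases "S = 0") (auto simp flip: S_def)
qed

text \<open>
  For \<open>x = \<Sum>\<^sub>i f\<^sub>i\<close> one has \<open>\<parallel>x\<parallel>\<^sup>2 = \<Sum>\<^sub>i \<langle>P\<^sub>i x, f\<^sub>i\<rangle>\<close>; Cauchy-Schwarz bounds this by the product of
  the Euclidean norms of \<open>(P\<^sub>i x)\<close> and \<open>(f\<^sub>i)\<close>, and the latter is at most \<open>\<parallel>x\<parallel> / sqrt (1 - r)\<close>.
\<close>

lemma sum_norm_proj_ge:
  assumes "x \<in> M"
  shows "(1 - r) * (norm x)\<^sup>2 \<le> (\<Sum>i<n. (norm (proj i x))\<^sup>2)"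
proof (cases "x = 0")
  case False
  obtain f where x: "x = (\<Sum>i<n. f i)" and f: "\<And>i. i < n \<Longrightarrow> f i \<in> X i"
    using assms unfolding subspace_sum_def by blast
  let ?p = "L2_set (\<lambda>i. norm (proj i x)) {..<n}" and ?f = "L2_set (\<lambda>i. norm (f i)) {..<n}"
  have "(norm x)\<^sup>2 = (\<Sum>i<n. inner x (f i))"
    by (simp add: power2_norm_eq_inner x inner_sum_right)
  also have "\<dots> \<le> (\<Sum>i<n. norm (proj i x) * norm (f i))"
    using f by (intro sum_mono) (metis inner_proj lessThan_iff norm_cauchy_schwarz)
  also have "\<dots> \<le> ?p * ?f"
    by (rule sum_mult_le_L2_set)
  finally have "((norm x)\<^sup>2)\<^sup>2 \<le> (?p * ?f)\<^sup>2"
    by (rule power_mono) simp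
  then have "(1 - r) * ((norm x)\<^sup>2)\<^sup>2 \<le> (1 - r) * (?p * ?f)\<^sup>2"
    using r_less_1 by (intro mult_left_mono) auto
  also have "\<dots> = ?p\<^sup>2 * ((1 - r) * ?f\<^sup>2)"
    by (simp add: power_mult_distrib mult_ac)
  also have "\<dots> \<le> ?p\<^sup>2 * (norm x)\<^sup>2"
    using norm_sum_lower[of f] f by (intro mult_left_mono zero_le_power2) (simp add: L2_set_power2 x)
  finally have "(norm x)\<^sup>2 * ((1 - r) * (norm x)\<^sup>2) \<le> (norm x)\<^sup>2 * ?p\<^sup>2"
    by (simp add: power2_eq_square mult_ac)
  then show ?thesis
    using False by (simp add: L2_set_power2)
qed (simp add: sum_nonneg)

lemma norm_T_le:
  assumes "x \<in> M"
  shows "norm (T x) \<le> r * norm x"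
proof (rule norm_le_of_symmetric_form[OF linear_T subspace_M T_in_M[OF assms] assms r_nonneg sym_T])
  fix y
  assume "y \<in> M"
  then show "\<bar>inner (T y) y\<bar> \<le> r * (norm y)\<^sup>2"
    using sum_norm_proj_le[of y] sum_norm_proj_ge[of y] by (simp add: inner_T abs_le_iff algebra_simps)
qed

lemma norm_funpow_T_le:
  assumes "x \<in> M"
  shows "norm ((T ^^ k) x) \<le> r ^ k * norm x"
proof -
  have in_M: "(T ^^ k) x \<in> M" for k
    using assms by (induction k) (simp_all add: T_in_M)
  show "norm ((T ^^ k) x) \<le> r ^ k * norm x"
  proof (induction k)
    case (Suc k)
    have "norm (T ((T ^^ k) x)) \<le> r * norm ((T ^^ k) x)"
      by (rule norm_T_le[OF in_M])
    also have "\<dots> \<le> r * (r ^ k * norm x)"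
      using Suc r_nonneg by (rule mult_left_mono)
    finally show ?case
      by (simp add: mult.assoc)
  qed simp
qed

lemma T_fixes_orthogonal:
  assumes "\<And>z. z \<in> M \<Longrightarrow> inner w z = 0"
  shows "T w = w"
proof -
  have "proj i w = 0" if "i < n" for i
  proof (rule orth_proj_unique[OF subspace_X[OF that]])
    show "0 \<in> X i"
      by (rule real_vector.subspace_0[OF subspace_X[OF that]])
    show "inner (w - 0) z = 0" if "z \<in> X i" for z
      using assms[OF X_subset_M[OF \<open>i < n\<close> that]] by simp
  qed
  then show ?thesis
    by (simp add: T_def)
qed

text \<open>
  Writing \<open>x = p + w\<close> with \<open>p\<close> the projection of \<open>x\<close> onto \<open>M\<close>, the part \<open>w\<close> is fixed by \<open>T\<close>, so the
  error operator sends \<open>x\<close> to \<open>- T ^ N p\<close>.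
\<close>

lemma onorm_iteration_error:
  "onorm (\<lambda>x. x - ((\<lambda>y. y - (\<Sum>i<n. proj i y)) ^^ N) x - orth_proj inner M x) \<le> r ^ N"
proof (rule onorm_bound)
  fix x
  let ?p = "orth_proj inner M x"
  have p: "?p \<in> M"
    by (intro orth_proj_in subspace_M closed_M)
  have "T (x - ?p) = x - ?p"
    by (intro T_fixes_orthogonal orth_proj_orth subspace_M closed_M)
  then have fix_w: "(T ^^ N) (x - ?p) = x - ?p"
    by (induction N) auto
  have "(T ^^ N) (u + v) = (T ^^ N) u + (T ^^ N) v" for u v
    by (induction N) (auto simp: linear_add[OF linear_T])
  from this[of ?p "x - ?p"] have "x - (T ^^ N) x - ?p = - (T ^^ N) ?p"
    by (simp add: fix_w)
  then have "norm (x - (T ^^ N) x - ?p) \<le> r ^ N * norm ?p"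
    using norm_funpow_T_le[OF p] by simp
  also have "\<dots> \<le> r ^ N * norm x"
    using r_nonneg by (intro mult_left_mono norm_orth_proj_le subspace_M closed_M) auto
  finally show "norm (x - ((\<lambda>y. y - (\<Sum>i<n. proj i y)) ^^ N) x - ?p) \<le> r ^ N * norm x"
    by (simp add: T_def[abs_def])
qed (use r_nonneg in simp)

end

section \<open>The error estimate\<close>

theorem theorem2p2:
  fixes n N :: nat
    and \<epsilon> :: "nat \<Rightarrow> nat \<Rightarrow> real"
    and X :: "nat \<Rightarrow> 'a::{real_inner, complete_space} set"
    and Y :: "nat \<Rightarrow> 'b::{complex_inner, complete_space} set"
  assumes "n \<ge> 1"
    and "N \<ge> 1"
    and "\<And>i j. i < n \<Longrightarrow> j < n \<Longrightarrow> i \<noteq> j \<Longrightarrow> \<epsilon> i j \<ge> 0"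
    and "\<And>i j. i < n \<Longrightarrow> j < n \<Longrightarrow> i \<noteq> j \<Longrightarrow> \<epsilon> i j = \<epsilon> j i"
    and "spectral_radius (offdiag_mat n \<epsilon>) < 1"
  shows
    "((\<forall>i<n. real_vector.subspace (X i) \<and> closed (X i)) \<longrightarrow>
      (\<forall>i<n. \<forall>j<n. i \<noteq> j \<longrightarrow> (\<forall>x\<in>X j. norm (orth_proj inner (X i) x) \<le> \<epsilon> i j * norm x)) \<longrightarrow>
      (let A = (\<lambda>x. \<Sum>i<n. orth_proj inner (X i) x);
           P = orth_proj inner (subspace_sum n X)
       in onorm (\<lambda>x. x - ((\<lambda>y. y - A y) ^^ N) x - P x) \<le> spectral_radius (offdiag_mat n \<epsilon>) ^ N))
     \<and>
     ((\<forall>i<n. csubspace (Y i) \<and> closed (Y i)) \<longrightarrow>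
      (\<forall>i<n. \<forall>j<n. i \<noteq> j \<longrightarrow> (\<forall>x\<in>Y j. norm (orth_proj cinner (Y i) x) \<le> \<epsilon> i j * norm x)) \<longrightarrow>
      (let A = (\<lambda>x. \<Sum>i<n. orth_proj cinner (Y i) x);
           P = orth_proj cinner (subspace_sum n Y)
       in onorm (\<lambda>x. x - ((\<lambda>y. y - A y) ^^ N) x - P x) \<le> spectral_radius (offdiag_mat n \<epsilon>) ^ N))"
proof -
  define E where "E = offdiag_mat n \<epsilon>"
  define r where "r = spectral_radius E"
  have carr: "E \<in> carrier_mat n n"
    by (simp add: E_def offdiag_mat_def)
  have "0 \<le> r"
    using spectral_radius_mem_max(1)[OF carr] assms(1) unfolding r_def by auto
  have E_mat: "E = mat n n (\<lambda>(i, j). complex_of_real (if i = j then 0 else \<epsilon> i j))"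
    unfolding E_def offdiag_mat_def by (rule cong_mat) auto
  have form: "(\<Sum>i<n. \<Sum>j<n. (if i = j then 0 else \<epsilon> i j) * a i * a j) \<le> r * (\<Sum>i<n. (a i)\<^sup>2)" for a
    unfolding r_def E_mat
    by (rule symmetric_form_le_spectral_radius) (use assms(1,4) in auto)
  have main: "onorm (\<lambda>x. x - ((\<lambda>y. y - (\<Sum>i<n. orth_proj inner (Z i) y)) ^^ N) x
        - orth_proj inner (subspace_sum n Z) x) \<le> r ^ N"
    if "\<forall>i<n. real_vector.subspace (Z i) \<and> closed (Z i)"
      and "\<forall>i<n. \<forall>j<n. i \<noteq> j \<longrightarrow> (\<forall>x\<in>Z j. norm (orth_proj inner (Z i) x) \<le> \<epsilon> i j * norm x)"
    for Z :: "nat \<Rightarrow> 'c::{real_inner, complete_space} set"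
  proof -
    interpret almost_orthogonal_subspaces n Z \<epsilon> r
      by standard (use that form \<open>0 \<le> r\<close> assms(5) in \<open>auto simp: r_def E_def\<close>)
    show ?thesis
      using onorm_iteration_error by simp
  qed
  show ?thesis
  proof (intro conjI impI)
    assume "\<forall>i<n. real_vector.subspace (X i) \<and> closed (X i)"
      and "\<forall>i<n. \<forall>j<n. i \<noteq> j \<longrightarrow> (\<forall>x\<in>X j. norm (orth_proj inner (X i) x) \<le> \<epsilon> i j * norm x)"
    from main[OF this]
    show "let A = (\<lambda>x. \<Sum>i<n. orth_proj inner (X i) x);
           P = orth_proj inner (subspace_sum n X)
       in onorm (\<lambda>x. x - ((\<lambda>y. y - A y) ^^ N) x - P x) \<le> spectral_radius (offdiag_mat n \<epsilon>) ^ N"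
      by (simp add: r_def E_def)
  next
    assume Y: "\<forall>i<n. csubspace (Y i) \<and> closed (Y i)"
      and bound: "\<forall>i<n. \<forall>j<n. i \<noteq> j \<longrightarrow> (\<forall>x\<in>Y j. norm (orth_proj cinner (Y i) x) \<le> \<epsilon> i j * norm x)"
    have proj_Y: "orth_proj cinner (Y i) = orth_proj inner (Y i)" if "i < n" for i
      using Y that by (simp add: orth_proj_cinner_eq_inner)
    have proj_sum: "orth_proj cinner (subspace_sum n Y) = orth_proj inner (subspace_sum n Y)"
      using Y by (simp add: orth_proj_cinner_eq_inner csubspace_subspace_sum)
    have "\<forall>i<n. real_vector.subspace (Y i) \<and> closed (Y i)"
      using Y by (simp add: csubspace_imp_subspace)
    moreover have "\<forall>i<n. \<forall>j<n. i \<noteq> j \<longrightarrow> (\<forall>x\<in>Y j. norm (orth_proj inner (Y i) x) \<le> \<epsilon> i j * norm x)"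
      using bound by (simp add: proj_Y)
    ultimately show "let A = (\<lambda>x. \<Sum>i<n. orth_proj cinner (Y i) x);
           P = orth_proj cinner (subspace_sum n Y)
       in onorm (\<lambda>x. x - ((\<lambda>y. y - A y) ^^ N) x - P x) \<le> spectral_radius (offdiag_mat n \<epsilon>) ^ N"
      using main[of Y] by (simp add: r_def E_def proj_Y proj_sum)
  qed
qed

end
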